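(* For all $\alpha,\beta\in\mathbb{C}$ with $\mathfrak{Re}(\beta)>0$ and $\mathfrak{Re}(\alpha)\ge1$, the following equalities hold: $$I_{0^+}^\alpha\left[(1-x)^{\beta-1}\log\Gamma(x)\right](1)=\frac{\Gamma(\alpha+\beta-1)}{\Gamma(\alpha)}\,I_{0^+}^{\alpha+\beta-1}\log\Gamma(1),$$ $$I_{1^-}^\alpha\left[(1-x)^{\beta-1}\log\Gamma(x)\right](0)=\frac{1}{\Gamma(\alpha)}\sum_{n=0}^{\infty}(-1)^n\binom{\beta-1}{n}\Gamma(n+\alpha)\,I_{1^-}^{n+\alpha}\log\Gamma(0).$$
   Context: $\Gamma$ is Euler's gamma function and $\log\Gamma(t)$ is the real logarithm for $t\in(0,1]$. For $\mathfrak{Re}(\alpha)>0$ the left- and right-sided Riemann-Liouville fractional integrals of order $\alpha$ of $f$ on $[a,b]$ are $I_{a^+}^\alpha f(x)=\frac{1}{\Gamma(\alpha)}\int_a^x (x-t)^{\alpha-1}f(t)\,dt$ ($a<x\le b$) and $I_{b^-}^\alpha f(x)=\frac{1}{\Gamma(\alpha)}\int_x^b (t-x)^{\alpha-1}f(t)\,dt$ ($a\le x<b$). Here $a=0$, $b=1$ (and the same formulas are used for complex-valued $f$ on $(0,1)$), so $I_{0^+}^\alpha[f(x)](1)=\frac{1}{\Gamma(\alpha)}\int_0^1(1-t)^{\alpha-1}f(t)\,dt$, $I_{1^-}^\alpha[f(x)](0)=\frac{1}{\Gamma(\alpha)}\int_0^1 t^{\alpha-1}f(t)\,dt$, $I_{0^+}^{s}\log\Gamma(1)=\frac{1}{\Gamma(s)}\int_0^1(1-t)^{s-1}\log\Gamma(t)\,dt$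 and $I_{1^-}^{s}\log\Gamma(0)=\frac{1}{\Gamma(s)}\int_0^1 t^{s-1}\log\Gamma(t)\,dt$. For positive real $y$ and complex $s$, $y^s=e^{s\log y}$. The generalized binomial coefficient is $\binom{\beta-1}{n}=\frac{(\beta-1)(\beta-2)\cdots(\beta-n)}{n!}$, equal to $1$ for $n=0$. *)

theory Defs
  imports "HOL-Analysis.Analysis"
begin

text \<open>
  Riemann-Liouville fractional integrals of complex order (meant for positive real part), as
  Lebesgue integrals over the open interval, since \<open>f\<close> need not be defined at the endpoints.
  On positive reals, complex \<open>powr\<close> is \<open>exp (s * ln y)\<close> with the real logarithm. The existence
  predicates are separate because the integral of a non-integrable function is \<open>0\<close> by convention.
\<close>

definition RL_left_integrand :: "complex \<Rightarrow> (real \<Rightarrow> complex) \<Rightarrow> real \<Rightarrow> real \<Rightarrow> complex" where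
  "RL_left_integrand \<alpha> f x t = complex_of_real (x - t) powr (\<alpha> - 1) * f t"

definition RL_right_integrand :: "complex \<Rightarrow> (real \<Rightarrow> complex) \<Rightarrow> real \<Rightarrow> real \<Rightarrow> complex" where
  "RL_right_integrand \<alpha> f x t = complex_of_real (t - x) powr (\<alpha> - 1) * f t"

definition RL_left_exists :: "real \<Rightarrow> complex \<Rightarrow> (real \<Rightarrow> complex) \<Rightarrow> real \<Rightarrow> bool" where
  "RL_left_exists a \<alpha> f x \<longleftrightarrow> set_integrable lborel {a<..<x} (RL_left_integrand \<alpha> f x)"

definition RL_right_exists :: "real \<Rightarrow> complex \<Rightarrow> (real \<Rightarrow> complex) \<Rightarrow> real \<Rightarrow> bool" where
  "RL_right_exists b \<alpha> f x \<longleftrightarrow> set_integrable lborel {x<..<b} (RL_right_integrand \<alpha> f x)"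

definition RL_left :: "real \<Rightarrow> complex \<Rightarrow> (real \<Rightarrow> complex) \<Rightarrow> real \<Rightarrow> complex" where
  "RL_left a \<alpha> f x = 1 / Gamma \<alpha> * (LINT t:{a<..<x}|lborel. RL_left_integrand \<alpha> f x t)"

definition RL_right :: "real \<Rightarrow> complex \<Rightarrow> (real \<Rightarrow> complex) \<Rightarrow> real \<Rightarrow> complex" where
  "RL_right b \<alpha> f x = 1 / Gamma \<alpha> * (LINT t:{x<..<b}|lborel. RL_right_integrand \<alpha> f x t)"

definition log_Gamma :: "real \<Rightarrow> complex" where
  "log_Gamma t = complex_of_real (ln (Gamma t))"

end

theory Submission
  imports Defs
begin

text \<open>
  All four fractional integrals are, up to a Gamma factor, integrals over \<open>(0,1)\<close> of the one
  family \<open>t\<^sup>p\<^sup>-\<^sup>1 (1 - t)\<^sup>q\<^sup>-\<^sup>1 log \<Gamma>(t)\<close>. The first equality is then the addition of exponents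
  of \<open>1 - t\<close>, and the second is the integrated binomial expansion of \<open>(1 - t)\<^sup>\<beta>\<^sup>-\<^sup>1\<close>.

  The analytic input is the size of \<open>log \<Gamma>\<close> on \<open>(0,1]\<close>. Log-convexity of \<open>\<Gamma>\<close> together with
  \<open>\<Gamma>(1) = \<Gamma>(2) = 1\<close> gives \<open>0 \<le> log \<Gamma>(t) \<le> - log t\<close>, so \<open>log \<Gamma>(t)\<close> is at most
  \<open>t\<^sup>-\<^sup>e / e\<close> for each \<open>e > 0\<close>: the singularity at \<open>0\<close> costs an arbitrarily small power of \<open>t\<close>.
  Each member of the family is therefore dominated by a Beta integrand and is integrable when
  \<open>Re p\<close> and \<open>Re q\<close> are positive (lemma \<open>set_integrable_beta_log_Gamma\<close>).

  For the series, the same bound with \<open>q = 1\<close> shows that the integral of the \<open>n\<close>-th term in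
  absolute value is \<open>O(\<bar>\<beta> - 1 choose n\<bar> / n)\<close>. Since the binomial coefficient is bounded by a multiple of
  \<open>n\<close> to the power \<open>- Re \<beta>\<close>, these integrals are summable for \<open>Re \<beta> > 0\<close>, and summation and
  integration may be interchanged (lemma \<open>set_integral_beta_log_Gamma_gchoose_sums\<close>).
\<close>

section \<open>The size of log Gamma on the unit interval\<close>

lemma Gamma_2_real: "Gamma (2::real) = 1"
  using Gamma_numeral[where ?'a = real, of "num.Bit0 num.One"] by simp

text \<open>
  The point \<open>1\<close> lies between \<open>t\<close> and \<open>2\<close>. As \<open>ln \<Gamma>\<close> is convex and vanishes at \<open>1\<close> and at \<open>2\<close>,
  it cannot be negative at \<open>t\<close>.
\<close>
lemma ln_Gamma_real_nonneg:
  assumes "0 < t" "t \<le> (1::real)"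
  shows "0 \<le> ln (Gamma t)"
proof -
  \<comment> \<open>\<open>u\<close> is the weight of \<open>t\<close> when \<open>1\<close> is written as a convex combination of \<open>t\<close> and \<open>2\<close>.\<close>
  define u where "u = 1 / (2 - t)"
  have u: "0 < u" "u \<le> 1" and one: "u * t + (1 - u) * 2 = 1"
    using assms by (auto simp: u_def divide_simps)
  have "ln (Gamma 1) \<le> u * ln (Gamma t) + (1 - u) * ln (Gamma (2::real))"
    using convex_onD[OF log_convex_Gamma_real, of "1 - u" t 2] assms u
    unfolding real_scaleR_def
    by (simp only: o_def one diff_diff_eq2 add_diff_cancel_left' greaterThan_iff)
  then have "0 \<le> u * ln (Gamma t)"
    by (simp add: Gamma_2_real)
  with u show ?thesis
    by (simp add: zero_le_mult_iff)
qed

text \<open>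
  Convexity between the zeros \<open>1\<close> and \<open>2\<close> gives \<open>ln \<Gamma>(t + 1) \<le> 0\<close>; the functional equation
  moves this to \<open>t\<close>.
\<close>
lemma ln_Gamma_real_le_minus_ln:
  assumes "0 < t" "t \<le> (1::real)"
  shows "ln (Gamma t) \<le> - ln t"
proof -
  have "ln (Gamma (t + 1)) \<le> (1 - t) * ln (Gamma 1) + t * ln (Gamma (2::real))"
    using convex_onD[OF log_convex_Gamma_real, of t 1 2] assms by (simp add: algebra_simps)
  moreover have "ln (Gamma (t + 1)) = ln t + ln (Gamma t)"
    using assms Gamma_plus1[of t] Gamma_real_pos[of t]
    by (simp add: ln_mult less_imp_neq[symmetric] nonpos_Ints_def)
  ultimately show ?thesis by (simp add: Gamma_2_real)
qed

lemma norm_log_Gamma_le: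
  assumes "0 < t" "t \<le> 1" "0 < e"
  shows "norm (log_Gamma t) \<le> t powr (- e) / e"
proof -
  have "- ln t \<le> (1 / t) powr e / e"
    using ln_powr_bound[of "1 / t" e] assms by (simp add: ln_div)
  also have "(1 / t) powr e = t powr (- e)"
    using assms by (simp add: powr_divide powr_minus_divide)
  finally show ?thesis
    using ln_Gamma_real_nonneg[OF assms(1,2)] ln_Gamma_real_le_minus_ln[OF assms(1,2)]
    by (simp add: log_Gamma_def)
qed

section \<open>Beta integrals weighted by log Gamma\<close>

definition beta_log_Gamma :: "complex \<Rightarrow> complex \<Rightarrow> real \<Rightarrow> complex" where
  "beta_log_Gamma p q t =
     complex_of_real t powr (p - 1) * complex_of_real (1 - t) powr (q - 1) * log_Gamma t"

lemma continuous_on_beta_log_Gamma: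
  "continuous_on {0<..<1} (beta_log_Gamma p q)"
  unfolding beta_log_Gamma_def log_Gamma_def
  by (intro continuous_intros)
     (auto simp: complex_nonpos_Reals_iff Gamma_eq_zero_iff elim!: nonpos_Ints_cases)

lemma norm_beta_log_Gamma_le:
  assumes "0 < t" "t < 1" "0 < e"
  shows "norm (beta_log_Gamma p q t) \<le>
    t powr (Re p - e - 1) * (1 - t) powr (Re q - 1) / e"
proof -
  have "norm (beta_log_Gamma p q t) \<le>
      t powr (Re p - 1) * (1 - t) powr (Re q - 1) * (t powr (- e) / e)"
    using assms mult_left_mono[OF norm_log_Gamma_le[of t e],
        of "t powr (Re p - 1) * (1 - t) powr (Re q - 1)"]
    by (simp add: beta_log_Gamma_def norm_mult norm_powr_real_powr)
  also have "\<dots> = (t powr (Re p - 1) * t powr (- e)) * (1 - t) powr (Re q - 1) / e"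
    by simp
  also have "t powr (Re p - 1) * t powr (- e) = t powr (Re p - e - 1)"
    by (simp flip: powr_add add: algebra_simps)
  finally show ?thesis .
qed

lemma set_integrable_beta_Ioo:
  assumes "0 < a" "0 < (b::real)"
  shows "set_integrable lborel {0<..<1} (\<lambda>t. t powr (a - 1) * (1 - t) powr (b - 1))"
  by (rule set_integrable_subset[OF integrable_Beta[OF assms]]) auto

lemma set_integral_beta_Ioo:
  assumes "0 < a" "0 < (b::real)"
  shows "(LINT t:{0<..<1}|lborel. t powr (a - 1) * (1 - t) powr (b - 1)) = Beta a b"
  using set_borel_integral_eq_integral(2)[OF set_integrable_beta_Ioo[OF assms]]
    has_integral_Beta_real[OF assms]
  by (simp add: has_integral_Icc_iff_Ioo integral_unique)

text \<open>
  Half of \<open>Re p\<close> suffices to absorb the logarithmic singularity at \<open>0\<close>, which leaves the Beta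
  integrand with parameters \<open>Re p / 2\<close> and \<open>Re q\<close> as a dominating function.
\<close>
lemma set_integrable_beta_log_Gamma:
  assumes "0 < Re p" "0 < Re q"
  shows "set_integrable lborel {0<..<1} (beta_log_Gamma p q)"
proof (rule set_integrable_bound)
  define e where "e = Re p / 2"
  have e: "0 < e" "0 < Re p - e"
    using assms by (auto simp: e_def)
  show "set_integrable lborel {0<..<1}
      (\<lambda>t. t powr (Re p - e - 1) * (1 - t) powr (Re q - 1) / e)"
    using set_integrable_beta_Ioo[OF e(2) assms(2)] by (rule set_integrable_divide)
  show "set_borel_measurable lborel {0<..<1} (beta_log_Gamma p q)"
    unfolding set_borel_measurable_def
    using borel_measurable_continuous_on_indicator[OF _ continuous_on_beta_log_Gamma] by simp
  show "AE t in lborel. t \<in> {0<..<1} \<longrightarrow> norm (beta_log_Gamma p q t) \<le>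
      norm (t powr (Re p - e - 1) * (1 - t) powr (Re q - 1) / e)"
    using norm_beta_log_Gamma_le[of _ e p q] e by auto
qed

lemma set_integral_norm_beta_log_Gamma_le:
  assumes "0 < e" "e < Re p" "0 < Re q"
  shows "(LINT t:{0<..<1}|lborel. norm (beta_log_Gamma p q t)) \<le> Beta (Re p - e) (Re q) / e"
proof -
  have "(LINT t:{0<..<1}|lborel. norm (beta_log_Gamma p q t)) \<le>
      (LINT t:{0<..<1}|lborel. t powr (Re p - e - 1) * (1 - t) powr (Re q - 1) / e)"
    using assms norm_beta_log_Gamma_le[of _ e p q]
    by (intro set_integral_mono set_integrable_norm set_integrable_beta_log_Gamma
        set_integrable_divide set_integrable_beta_Ioo) auto
  also have "\<dots> = Beta (Re p - e) (Re q) / e"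
    using assms by (simp add: set_integral_beta_Ioo)
  finally show ?thesis .
qed

section \<open>The binomial series under the integral\<close>

lemma gchoose_bigo_powr:
  fixes z :: complex
  shows "(\<lambda>n. norm (z gchoose n)) \<in> O(\<lambda>n. real n powr (- Re z - 1))"
proof -
  obtain K where K: "norm ((z gchoose n) / ((-1) ^ n / exp ((z + 1) * of_real (ln (real n))))) \<le> K" for n
    using convergent_imp_Bseq[OF convergentI[OF gbinomial_asymptotic[of z]]]
    unfolding Bseq_def by auto
  show ?thesis
  proof (rule bigoI[of _ K], rule eventually_mono[OF eventually_gt_at_top[of 0]])
    fix n :: nat assume n: "n > 0"
    have "norm (z gchoose n) * real n powr (Re z + 1) \<le> K"
      using K[of n] n by (simp add: norm_divide norm_mult norm_power powr_def)
    then show "norm (norm (z gchoose n)) \<le> K * norm (real n powr (- Re z - 1))"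
      using n powr_minus_divide[of "real n" "Re z + 1"] by (simp add: pos_le_divide_eq)
  qed
qed

text \<open>
  The coefficients are of order at most \<open>n\<close> to the power \<open>- Re \<beta>\<close>, so for small \<open>Re \<beta>\<close> they need not be
  absolutely summable on their own; one further factor \<open>1 / n\<close> makes them so.
\<close>
lemma summable_gchoose_divide:
  fixes \<beta> :: complex
  assumes "0 < Re \<beta>" "0 < c"
  shows "summable (\<lambda>n. norm ((\<beta> - 1) gchoose n) / (real n + c))"
proof (rule summable_comparison_test_bigo)
  show "summable (\<lambda>n. norm (real n powr (- Re \<beta> - 1)))"
    using assms by (simp add: summable_real_powr_iff)
  have "(\<lambda>n. inverse (real n + c)) \<in> O(\<lambda>n. real n powr - 1)"
    using assms
    by (intro bigoI[of _ 1] eventually_mono[OF eventually_gt_at_top[of 0]])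
       (auto simp: powr_minus intro!: le_imp_inverse_le)
  from landau_o.big.mult[OF gchoose_bigo_powr[of "\<beta> - 1"] this]
  have "(\<lambda>n. norm ((\<beta> - 1) gchoose n) * inverse (real n + c)) \<in>
      O(\<lambda>n. real n powr (- Re \<beta> + - 1))"
    by (simp only: powr_add) simp
  then   show "(\<lambda>n. norm ((\<beta> - 1) gchoose n) / (real n + c)) \<in> O(\<lambda>n. real n powr (- Re \<beta> - 1))"
    by (simp add: divide_inverse)
qed

lemma beta_log_Gamma_add_nat:
  assumes "0 < t"
  shows "beta_log_Gamma (of_nat n + p) q t = of_real t ^ n * beta_log_Gamma p q t"
proof -
  have "complex_of_real t powr (of_nat n + p - 1) = of_real t ^ n * of_real t powr (p - 1)"
    using assms by (simp only: add_diff_eq[symmetric] powr_add powr_nat') simp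
  then show ?thesis
    by (simp add: beta_log_Gamma_def)
qed

lemma beta_log_Gamma_gchoose_sums:
  assumes "0 < t" "t < 1"
  shows "(\<lambda>n. (-1) ^ n * ((q - 1) gchoose n) * beta_log_Gamma (of_nat n + p) 1 t)
    sums beta_log_Gamma p q t"
proof -
  have "(\<lambda>n. ((q - 1) gchoose n) * (- of_real t) ^ n * beta_log_Gamma p 1 t)
      sums ((1 + - of_real t) powr (q - 1) * beta_log_Gamma p 1 t)"
    using assms by (intro sums_mult2 gen_binomial_complex) simp
  then show ?thesis
    using assms
    by (simp add: beta_log_Gamma_add_nat power_minus[of "of_real t"] mult_ac)
       (simp add: beta_log_Gamma_def mult_ac)
qed

lemma Beta_one_right:
  assumes "0 < (x::real)"
  shows "Beta x 1 = 1 / x"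
  using assms Gamma_plus1[of x] Gamma_real_pos[of x]
  by (simp add: Beta_def less_imp_neq[symmetric] nonpos_Ints_def)

text \<open>
  The expansion of \<open>(1 - t)\<^sup>q\<^sup>-\<^sup>1\<close> may diverge at \<open>t = 1\<close>, so uniform convergence is not available.
  Instead, the integrals of the absolute values of the terms are summable: each factor \<open>t\<^sup>n\<close>
  concentrates near \<open>1\<close>, where \<open>log \<Gamma>\<close> is bounded, and contributes \<open>1 / n\<close>.
\<close>
lemma set_integral_beta_log_Gamma_gchoose_sums:
  assumes p: "0 < Re p" and q: "0 < Re q"
  shows "(\<lambda>n. (-1) ^ n * ((q - 1) gchoose n) *
      (LINT t:{0<..<1}|lborel. beta_log_Gamma (of_nat n + p) 1 t))
    sums (LINT t:{0<..<1}|lborel. beta_log_Gamma p q t)"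
proof -
  define c where "c n = (-1) ^ n * ((q - 1) gchoose n)" for n
  define F where "F n t = indicator {0<..<1} t *\<^sub>R (c n * beta_log_Gamma (of_nat n + p) 1 t)"
    for n and t :: real
  \<comment> \<open>One \<open>e\<close> serves all terms, because \<open>Re p\<close> is the smallest of the exponents \<open>n + Re p\<close>.\<close>
  define e where "e = Re p / 2"
  have e: "0 < e" "e < Re p"
    using p by (auto simp: e_def)
  have norm_c: "norm (c n) = norm ((q - 1) gchoose n)" for n
    by (simp add: c_def norm_mult norm_power)
  have pointwise: "F n t = (if t \<in> {0<..<1} then
      ((q - 1) gchoose n) * (- of_real t) ^ n * beta_log_Gamma p 1 t else 0)" for n t
    by (auto simp: F_def c_def beta_log_Gamma_add_nat power_minus[of "of_real t"])
  have integrable: "integrable lborel (F n)" for n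
    using set_integrable_beta_log_Gamma[of "of_nat n + p" 1] p
    unfolding F_def set_integrable_def[symmetric] by simp
  have summable: "AE t in lborel. summable (\<lambda>n. norm (F n t))"
  proof (rule AE_I2)
    fix t :: real
    show "summable (\<lambda>n. norm (F n t))"
    proof (cases "t \<in> {0<..<1}")
      case True
      have "summable (\<lambda>n. norm (((q - 1) gchoose n) * (- of_real t) ^ n))"
        using True by (intro abs_summable_in_conv_radius) (auto simp: conv_radius_gchoose)
      then have "summable (\<lambda>n. norm (((q - 1) gchoose n) * (- of_real t) ^ n) *
          norm (beta_log_Gamma p 1 t))"
        by (rule summable_mult2)
      with True show ?thesis by (simp add: pointwise norm_mult)
    qed (simp only: pointwise if_False norm_zero summable_zero)
  qed
  have norm_bound: "(\<integral>t. norm (F n t) \<partial>lborel) \<le>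
      norm ((q - 1) gchoose n) / (real n + (Re p - e)) / e" for n
  proof -
    have "(\<integral>t. norm (F n t) \<partial>lborel) =
        norm (c n) * (LINT t:{0<..<1}|lborel. norm (beta_log_Gamma (of_nat n + p) 1 t))"
      by (simp add: F_def set_lebesgue_integral_def norm_mult mult.left_commute)
    also have "\<dots> \<le> norm (c n) * (Beta (Re (of_nat n + p) - e) (Re 1) / e)"
      using e by (intro mult_left_mono set_integral_norm_beta_log_Gamma_le) auto
    also have "\<dots> = norm ((q - 1) gchoose n) / (real n + (Re p - e)) / e"
      using e by (simp add: norm_c Beta_one_right add_diff_eq)
    finally show ?thesis .
  qed
  have "summable (\<lambda>n. \<integral>t. norm (F n t) \<partial>lborel)"
  proof (rule summable_comparison_test'[OF summable_divide[OF summable_gchoose_divide[OF q]]])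
    show "0 < Re p - e" using e by simp
    show "norm (\<integral>t. norm (F n t) \<partial>lborel) \<le>
        norm ((q - 1) gchoose n) / (real n + (Re p - e)) / e" if "n \<ge> 0" for n
      using norm_bound[of n] by simp
  qed
  from sums_integral[OF integrable summable this]
  have "(\<lambda>n. \<integral>t. F n t \<partial>lborel) sums (\<integral>t. (\<Sum>n. F n t) \<partial>lborel)" .
  moreover have "(\<integral>t. F n t \<partial>lborel) =
      c n * (LINT t:{0<..<1}|lborel. beta_log_Gamma (of_nat n + p) 1 t)" for n
    unfolding F_def set_lebesgue_integral_def[symmetric] by simp
  moreover have "(\<Sum>n. F n t) = indicator {0<..<1} t *\<^sub>R beta_log_Gamma p q t" for t
    using sums_unique[OF beta_log_Gamma_gchoose_sums[of t q p]]
    by (cases "t \<in> {0<..<1}") (auto simp: F_def c_def)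
  ultimately show ?thesis
    by (simp add: c_def set_lebesgue_integral_def)
qed

section \<open>Fractional integrals of log Gamma\<close>

lemma RL_left_via_beta_log_Gamma:
  assumes "\<And>t. t \<in> {0<..<1} \<Longrightarrow> RL_left_integrand a f 1 t = beta_log_Gamma p q t"
  shows "RL_left_exists 0 a f 1 \<longleftrightarrow> set_integrable lborel {0<..<1} (beta_log_Gamma p q)"
    and "RL_left 0 a f 1 = 1 / Gamma a * (LINT t:{0<..<1}|lborel. beta_log_Gamma p q t)"
proof -
  show "RL_left_exists 0 a f 1 \<longleftrightarrow> set_integrable lborel {0<..<1} (beta_log_Gamma p q)"
    unfolding RL_left_exists_def using assms by (intro set_integrable_cong refl)
  show "RL_left 0 a f 1 = 1 / Gamma a * (LINT t:{0<..<1}|lborel. beta_log_Gamma p q t)"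
    unfolding RL_left_def using assms by (subst set_lebesgue_integral_cong) auto
qed

lemma RL_right_via_beta_log_Gamma:
  assumes "\<And>t. t \<in> {0<..<1} \<Longrightarrow> RL_right_integrand a f 0 t = beta_log_Gamma p q t"
  shows "RL_right_exists 1 a f 0 \<longleftrightarrow> set_integrable lborel {0<..<1} (beta_log_Gamma p q)"
    and "RL_right 1 a f 0 = 1 / Gamma a * (LINT t:{0<..<1}|lborel. beta_log_Gamma p q t)"
proof -
  show "RL_right_exists 1 a f 0 \<longleftrightarrow> set_integrable lborel {0<..<1} (beta_log_Gamma p q)"
    unfolding RL_right_exists_def using assms by (intro set_integrable_cong refl)
  show "RL_right 1 a f 0 = 1 / Gamma a * (LINT t:{0<..<1}|lborel. beta_log_Gamma p q t)"
    unfolding RL_right_def using assms by (subst set_lebesgue_integral_cong) auto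
qed

theorem theorem4:
  fixes \<alpha> \<beta> :: complex
  assumes "Re \<beta> > 0" and "Re \<alpha> \<ge> 1"
  shows "let g = (\<lambda>x::real. complex_of_real (1 - x) powr (\<beta> - 1) * log_Gamma x) in
    (RL_left_exists 0 \<alpha> g 1 \<and>
     RL_left_exists 0 (\<alpha> + \<beta> - 1) log_Gamma 1 \<and>
     RL_left 0 \<alpha> g 1 =
       Gamma (\<alpha> + \<beta> - 1) / Gamma \<alpha> * RL_left 0 (\<alpha> + \<beta> - 1) log_Gamma 1) \<and>
    (RL_right_exists 1 \<alpha> g 0 \<and>
     (\<forall>n::nat. RL_right_exists 1 (of_nat n + \<alpha>) log_Gamma 0) \<and>
     summable (\<lambda>n::nat. (-1) ^ n * ((\<beta> - 1) gchoose n) * Gamma (of_nat n + \<alpha>) *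
                 RL_right 1 (of_nat n + \<alpha>) log_Gamma 0) \<and>
     RL_right 1 \<alpha> g 0 =
       1 / Gamma \<alpha> * (\<Sum>n::nat. (-1) ^ n * ((\<beta> - 1) gchoose n) * Gamma (of_nat n + \<alpha>) *
                 RL_right 1 (of_nat n + \<alpha>) log_Gamma 0))"
proof -
  define g where "g = (\<lambda>x::real. complex_of_real (1 - x) powr (\<beta> - 1) * log_Gamma x)"
  define J where "J p q = (LINT t:{0<..<1}|lborel. beta_log_Gamma p q t)" for p q
  have Gamma_nonzero: "Gamma z \<noteq> 0" if "0 < Re z" for z :: complex
    using that by (auto simp: Gamma_eq_zero_iff elim!: nonpos_Ints_cases)
  have same_integrand: "RL_left_integrand \<alpha> g 1 t = beta_log_Gamma 1 (\<alpha> + \<beta> - 1) t"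
    if "t \<in> {0<..<1}" for t
  proof -
    have "complex_of_real (1 - t) powr (\<alpha> - 1) * complex_of_real (1 - t) powr (\<beta> - 1) =
        complex_of_real (1 - t) powr (\<alpha> + \<beta> - 1 - 1)"
      by (simp flip: powr_add add: algebra_simps)
    then show ?thesis
      using that by (simp add: RL_left_integrand_def g_def beta_log_Gamma_def del: of_real_diff)
  qed
  have left_g: "RL_left_exists 0 \<alpha> g 1 \<longleftrightarrow>
      set_integrable lborel {0<..<1} (beta_log_Gamma 1 (\<alpha> + \<beta> - 1))"
    "RL_left 0 \<alpha> g 1 = 1 / Gamma \<alpha> * J 1 (\<alpha> + \<beta> - 1)"
    unfolding J_def by (rule RL_left_via_beta_log_Gamma, erule same_integrand)+
  have left: "RL_left_exists 0 p log_Gamma 1 \<longleftrightarrow>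
      set_integrable lborel {0<..<1} (beta_log_Gamma 1 p)"
    "RL_left 0 p log_Gamma 1 = 1 / Gamma p * J 1 p" for p
    unfolding J_def
    by (rule RL_left_via_beta_log_Gamma, simp add: RL_left_integrand_def beta_log_Gamma_def)+
  have right_g: "RL_right_exists 1 \<alpha> g 0 \<longleftrightarrow>
      set_integrable lborel {0<..<1} (beta_log_Gamma \<alpha> \<beta>)"
    "RL_right 1 \<alpha> g 0 = 1 / Gamma \<alpha> * J \<alpha> \<beta>"
    unfolding J_def
    by (rule RL_right_via_beta_log_Gamma,
        simp add: RL_right_integrand_def g_def beta_log_Gamma_def)+
  have right: "RL_right_exists 1 p log_Gamma 0 \<longleftrightarrow>
      set_integrable lborel {0<..<1} (beta_log_Gamma p 1)"
    "RL_right 1 p log_Gamma 0 = 1 / Gamma p * J p 1" for p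
    unfolding J_def
    by (rule RL_right_via_beta_log_Gamma, simp add: RL_right_integrand_def beta_log_Gamma_def)+
  have series: "(\<lambda>n. (-1) ^ n * ((\<beta> - 1) gchoose n) * Gamma (of_nat n + \<alpha>) *
      RL_right 1 (of_nat n + \<alpha>) log_Gamma 0) sums J \<alpha> \<beta>"
    using assms set_integral_beta_log_Gamma_gchoose_sums[of \<alpha> \<beta>]
      Gamma_nonzero[of "of_nat _ + \<alpha>"]
    by (simp add: right J_def mult.assoc)
  have "Gamma (\<alpha> + \<beta> - 1) \<noteq> 0"
    using assms by (intro Gamma_nonzero) simp
  then show ?thesis
    unfolding Let_def g_def[symmetric] sums_unique[OF series, symmetric]
    using assms sums_summable[OF series]
    by (auto simp: left_g left right_g right intro!: set_integrable_beta_log_Gamma)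
qed

end
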